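(* Let $k\geqslant 3$ be an integer and let $A=\{0=a_{0}<a_{1}<\cdots<a_{k-1}\}$ be a set of $k$ integers such that $a_{k-2}<2k-4$, $a_{k-1}\geqslant 2k-2$ and $\gcd(A)=1$. Then $|2^{\wedge}A|\geqslant 3k-7$.
   Context: For a set $A$ of integers, $2^{\wedge}A=\{a+b: a,b\in A,\ a\neq b\}$ is the set of all sums of two distinct elements of $A$, and $\gcd(A)$ is the greatest common divisor of all nonzero elements of $A$. *)

theory Defs
  imports Main
begin

definition restricted_sumset :: "int set \<Rightarrow> int set" where
  "restricted_sumset A = {a + b | a b. a \<in> A \<and> b \<in> A \<and> a \<noteq> b}"

definition set_gcd :: "int set \<Rightarrow> int" where
  "set_gcd A = Gcd (A - {0})"

end

theory Submission
  imports Defs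
begin

text \<open>
Let \<open>B\<close> be \<open>A\<close> without its largest element, \<open>m\<close> the maximum of \<open>B\<close>, and \<open>m + w\<close> the element removed.
The bound on \<open>m\<close> says that \<open>B\<close> occupies more than half of \<open>[0, m]\<close>: if there are \<open>h\<close> holes, then
\<open>m = 2 h + c\<close> with \<open>c \<ge> 1\<close>. The bound on \<open>m + w\<close> says that \<open>w = c + t + 2\<close> with \<open>t \<ge> 0\<close>.

Fold the line at \<open>m\<close>. For \<open>0 < v < m\<close> the two numbers \<open>v\<close> and \<open>v + m\<close> are candidates for \<open>2^A\<close>; if \<open>v \<in> B\<close>,
both are sums, since \<open>0\<close> and \<open>m\<close> are in \<open>B\<close>. So only the holes \<open>v\<close> matter: call a hole poor if
neither candidate is a sum and rich if both are. From \<open>2 m\<close> on there are the sums \<open>b + (m + w)\<close> with \<open>b \<ge> m - w\<close>, and they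
are few exactly when the top window \<open>[m - w, m)\<close> has many holes. Counting everything, the theorem
becomes: the poor holes and the holes in the top window together exceed the rich holes by at most
\<open>t + 3\<close> (lemma \<open>poor_top_rich\<close>).

Poor holes are rare. Follow the walk \<open>bal\<close> that rises by 1 at a hole and falls by 1 at an element of \<open>B\<close>. By
pigeonhole, \<open>v\<close> can fail to be a sum of two distinct elements of \<open>B\<close> only where \<open>bal\<close> is nonnegative, and
\<open>v + m\<close> can fail only where it is at most \<open>2 - c\<close>. Hence for \<open>c \<ge> 3\<close> the two never fail together. For \<open>c \<le> 2\<close>
they may, but then the pigeonhole is tight: modulo \<open>m\<close>, the reflection \<open>z \<mapsto> v - z\<close> exchanges \<open>B\<close> with its
complement, apart from fixed points. Three such reflections are incompatible, so there are at most two
poor holes (lemma \<open>card_doubles\<close>).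

Rich holes come from translation by \<open>w\<close>: if \<open>v\<close> is a hole and \<open>v - w \<in> B\<close>, then \<open>v + m = (v - w) + (m + w)\<close> is a sum,
so \<open>v\<close> is rich as soon as \<open>v\<close> is itself a sum. If the top window has more holes than some lower
window \<open>(p, p + w]\<close>, then on the way up the surplus holes must start at such places \<open>v\<close>, which bounds the
number of rich holes from below (lemma \<open>chain\<close>). It remains to choose a lower window with few holes. With at
most one poor hole, a window starting at the last nonnegative value of \<open>bal\<close> below the top
window works. With two poor holes, the reflection in one of them maps a window just above it onto the top
window, or a window around its midpoint essentially onto itself, and either gives a good \<open>p\<close>, up to a few small
configurations that are contradictory; if both lie in the top window, the first window \<open>[0, w)\<close> has no holes (lemma \<open>two_poor\<close>).
\<close>

lemma restricted_sumsetI: "a \<in> A \<Longrightarrow> b \<in> A \<Longrightarrow> a \<noteq> b \<Longrightarrow> s = a + b \<Longrightarrow> s \<in> restricted_sumset A"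
  unfolding restricted_sumset_def by blast

section \<open>Dense sets and their balance walk\<close>

text \<open>The set \<open>B\<close> has \<open>h\<close> holes in \<open>[0, m]\<close>; the excess \<open>c\<close> measures how far the density is above one half.\<close>
locale dense_block =
  fixes B :: "int set" and m h c :: int
  assumes B_sub: "B \<subseteq> {0..m}"
    and zero_in: "0 \<in> B" and m_in: "m \<in> B"
    and card_B: "int (card B) = m + 1 - h"
    and m_eq: "m = 2 * h + c" and c_pos: "1 \<le> c"
begin

abbreviation RS :: "int set" where "RS \<equiv> restricted_sumset B"

definition gaps :: "int \<Rightarrow> int \<Rightarrow> int" where
  "gaps a b = int (card ({a<..b} - B))"

text \<open>The balance is the number of holes minus the number of elements in \<open>[0, v]\<close>, plus one. The shift makes
\<open>bal 0 = 0\<close> and turns the pigeonhole bounds below into sign conditions.\<close>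
definition bal :: "int \<Rightarrow> int" where
  "bal v = 2 * gaps (-1) v - v"

text \<open>Modulo \<open>m\<close>, these are the residues that no restricted sum of \<open>B\<close> represents.\<close>
definition doubly_missing :: "int \<Rightarrow> bool" where
  "doubly_missing y \<longleftrightarrow> 0 < y \<and> y < m \<and> y \<notin> RS \<and> y + m \<notin> RS"

lemma finite_B: "finite B"
  using B_sub finite_subset by blast

lemma h_nonneg: "0 \<le> h"
proof -
  have "card B \<le> card {0..m}" by (rule card_mono) (use B_sub in auto)
  moreover have "0 \<le> m" using B_sub m_in by auto
  ultimately show ?thesis using card_B by simp
qed

lemma m_pos: "0 < m" using h_nonneg m_eq c_pos by linarith

lemma B_bounds: "z \<in> B \<Longrightarrow> 0 \<le> z \<and> z \<le> m" using B_sub by auto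

lemma gaps_nonneg: "0 \<le> gaps a b" by (simp add: gaps_def)

lemma gaps_le: "a \<le> b \<Longrightarrow> gaps a b \<le> b - a"
proof -
  assume "a \<le> b"
  have "card ({a<..b} - B) \<le> card {a<..b}" by (rule card_mono) auto
  then show ?thesis using \<open>a \<le> b\<close> by (simp add: gaps_def)
qed

lemma gaps_self [simp]: "gaps a a = 0" by (simp add: gaps_def)

lemma gaps_split: 
  assumes "a \<le> b" "b \<le> d" shows "gaps a d = gaps a b + gaps b d"
proof -
  have "{a<..d} - B = ({a<..b} - B) \<union> ({b<..d} - B)" using assms by auto
  moreover have "card (({a<..b} - B) \<union> ({b<..d} - B)) = card ({a<..b} - B) + card ({b<..d} - B)"
    by (rule card_Un_disjoint) auto
  ultimately show ?thesis by (simp add: gaps_def)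
qed

lemma gaps_add_card: 
  assumes "a \<le> b" shows "gaps a b + int (card ({a<..b} \<inter> B)) = b - a"
proof -
  have "card {a<..b} = card ({a<..b} \<inter> B) + card ({a<..b} - B)"
    using card_Int_Diff by blast
  then show ?thesis using assms by (simp add: gaps_def)
qed

lemma gaps_total: "gaps (-1) m = h"
proof -
  have "{-1<..m} \<inter> B = B" using B_sub by auto
  then show ?thesis using gaps_add_card[of "-1" m] card_B m_pos by simp
qed

lemma gaps_unit: "gaps (v - 1) v = (if v \<in> B then 0 else 1)"
proof -
  have "{v - 1<..v} = {v}" by auto
  moreover have "{v} - B = (if v \<in> B then {} else {v})" by auto
  ultimately show ?thesis by (simp add: gaps_def)
qed

lemma gaps_bal: "-1 \<le> a \<Longrightarrow> a \<le> b \<Longrightarrow> 2 * gaps a b = bal b - bal a + (b - a)"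
  using gaps_split[of "-1" a b] by (simp add: bal_def)

lemma bal_minus_one: "bal (-1) = 1" by (simp add: bal_def)

lemma bal_step: "0 \<le> v \<Longrightarrow> bal v = bal (v - 1) + (if v \<in> B then -1 else 1)"
  using gaps_bal[of "v - 1" v] gaps_unit[of v] by (auto split: if_splits)

lemma bal_zero: "bal 0 = 0"
  using bal_step[of 0] bal_minus_one zero_in by simp

lemma bal_last: "bal (m - 1) = 1 - c"
proof -
  have "bal m = - c" using gaps_total m_eq by (simp add: bal_def)
  then show ?thesis using bal_step[of m] m_in m_pos by simp
qed

lemma bal_up: "-1 \<le> a \<Longrightarrow> a \<le> b \<Longrightarrow> bal b \<le> bal a + (b - a)"
  using gaps_bal[of a b] gaps_le[of a b] by linarith

lemma bal_down: "-1 \<le> a \<Longrightarrow> a \<le> b \<Longrightarrow> bal a - (b - a) \<le> bal b"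
  using gaps_bal[of a b] gaps_nonneg[of a b] by linarith

lemma bal_le: "-1 \<le> v \<Longrightarrow> v \<le> m \<Longrightarrow> bal v \<le> 2 * h - v"
  using gaps_split[of "-1" v m] gaps_nonneg[of v m] gaps_total by (simp add: bal_def)

lemma bal_parity: "even (bal v + v)" by (simp add: bal_def)

text \<open>A stretch on which the walk climbs at full speed consists of holes.\<close>
lemma climbing_run_avoids_B:
  assumes "-1 \<le> a" "bal b = bal a + (b - a)" "a < v" "v \<le> b"
  shows "v \<notin> B"
proof
  assume "v \<in> B"
  then have "bal v = bal (v - 1) - 1" using bal_step[of v] assms by auto
  then show False using bal_up[of a "v - 1"] bal_up[of v b] assms by auto
qed

section \<open>Missing sums and the balance\<close>

text \<open>Pigeonhole for the reflection in the centre of \<open>[a, b]\<close>: it sends the elements of \<open>B\<close>, except possibly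
the centre, injectively to holes. A hole opposite to a hole is missed by this injection, which
raises the bound by 2.\<close>
lemma reflection_count:
  assumes ab: "a \<le> b"
    and refl: "\<And>z. z \<in> B \<Longrightarrow> a \<le> z \<Longrightarrow> z \<le> b \<Longrightarrow> a + b - z \<in> B \<Longrightarrow> 2 * z = a + b"
  shows "b - a \<le> 2 * gaps (a - 1) b"
    and "a \<le> u \<Longrightarrow> u \<le> b \<Longrightarrow> u \<notin> B \<Longrightarrow> a + b - u \<notin> B \<Longrightarrow> b - a + 2 \<le> 2 * gaps (a - 1) b"
proof -
  define N where "N = {a..b} - B"
  define P where "P = {a..b} \<inter> B"
  define Q where "Q = {z \<in> P. 2 * z \<noteq> a + b}"
  have fin: "finite P" "finite N" "finite Q" unfolding P_def N_def Q_def by (auto intro: finite_subset[of _ "{a..b}"])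
  have iv: "{a - 1<..b} = {a..b}" by auto
  have tot: "int (card P) + int (card N) = b - a + 1"
    using gaps_add_card[of "a - 1" b] ab unfolding gaps_def iv P_def N_def by simp
  have gN: "gaps (a - 1) b = int (card N)" unfolding gaps_def iv N_def by simp
  have PQ: "card P \<le> card Q + 1"
  proof -
    have "P \<subseteq> insert ((a + b) div 2) Q" unfolding Q_def by auto
    then have "card P \<le> card (insert ((a + b) div 2) Q)" using fin by (intro card_mono) auto
    also have "\<dots> \<le> card Q + 1" using card_insert_le_m1 by (simp add: card_insert_if fin)
    finally show ?thesis .
  qed
  have inj: "inj_on (\<lambda>z. a + b - z) Q" by (auto simp: inj_on_def)
  have sub: "(\<lambda>z. a + b - z) ` Q \<subseteq> N"
    using refl unfolding Q_def P_def N_def by auto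
  have "card Q \<le> card N" using card_inj_on_le[OF inj sub] fin by simp
  then show "b - a \<le> 2 * gaps (a - 1) b" using PQ tot gN by linarith
  show "b - a + 2 \<le> 2 * gaps (a - 1) b"
    if u: "a \<le> u" "u \<le> b" "u \<notin> B" "a + b - u \<notin> B"
  proof -
    have sub': "(\<lambda>z. a + b - z) ` Q \<subseteq> N - {u, a + b - u}"
      using sub u unfolding Q_def P_def by auto
    have uN: "{u, a + b - u} \<subseteq> N" using u unfolding N_def by auto
    have le: "card Q \<le> card (N - {u, a + b - u})"
      using card_inj_on_le[OF inj sub'] fin by simp
    have le2: "card Q + card {u, a + b - u} \<le> card N"
      using le uN fin card_mono[OF fin(2) uN] by (simp add: card_Diff_subset)
    show ?thesis
    proof (cases "2 * u = a + b")
      case True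
      have "z \<noteq> u" if "z \<in> P" for z using that u unfolding P_def by blast
      then have "P = Q" using True unfolding Q_def by fastforce
      then have "card P = card Q" by simp
      moreover have "a + b - u = u" using True by simp
      then have "card {u, a + b - u} = 1" by simp
      ultimately show ?thesis using le2 tot gN by linarith
    next
      case False
      then have "u \<noteq> a + b - u" by auto
      then have "card {u, a + b - u} = 2" by (simp only: card_2_iff) blast
      then show ?thesis using le2 tot gN PQ by linarith
    qed
  qed
qed

lemma RS_I: "a \<in> B \<Longrightarrow> b \<in> B \<Longrightarrow> a \<noteq> b \<Longrightarrow> a + b \<in> RS"
  using restricted_sumsetI by blast

lemma not_in_B_if_missing: "0 < v \<Longrightarrow> v \<notin> RS \<Longrightarrow> v \<notin> B"
  using RS_I[OF zero_in, of v] by auto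

lemma not_in_B_if_missing_high: "v < m \<Longrightarrow> v + m \<notin> RS \<Longrightarrow> v \<notin> B"
  using RS_I[of v m] m_in by auto

text \<open>If \<open>v\<close> is not a sum, the reflection \<open>z \<mapsto> v - z\<close> of \<open>[0, v]\<close> produces at least as many holes as elements, the
centre aside.\<close>
lemma bal_missing:
  assumes "0 < v" "v \<notin> RS" shows "0 \<le> bal v"
proof -
  have "v - 0 \<le> 2 * gaps (0 - 1) v"
  proof (rule reflection_count(1))
    fix z assume "z \<in> B" "0 + v - z \<in> B"
    then show "2 * z = 0 + v" using RS_I[of z "v - z"] assms by (cases "z = v - z") auto
  qed (use assms in simp)
  then show ?thesis by (simp add: bal_def)
qed

text \<open>The same argument on \<open>[v, m]\<close>, rewritten through the holes below \<open>v\<close> because the total number of holes is \<open>h\<close>.\<close>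
lemma bal_missing_high:
  assumes "0 \<le> v" "v < m" "v + m \<notin> RS" shows "bal (v - 1) \<le> 1 - c"
proof -
  have "m - v \<le> 2 * gaps (v - 1) m"
  proof (rule reflection_count(1))
    fix z assume "z \<in> B" "v + m - z \<in> B"
    then show "2 * z = v + m" using RS_I[of z "v + m - z"] assms by (cases "z = v + m - z") auto
  qed (use assms in simp)
  moreover have "2 * gaps (v - 1) m = bal m - bal (v - 1) + (m - v + 1)"
    using gaps_bal[of "v - 1" m] assms by simp
  moreover have "bal m = - c" using gaps_total m_eq by (simp add: bal_def)
  ultimately show ?thesis by linarith
qed

text \<open>The two pigeonhole bounds pinch the balance between \<open>0\<close> and \<open>2 - c\<close>, which is impossible for \<open>c \<ge> 3\<close>.\<close>
lemma doubleD:
  assumes "doubly_missing y"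
  shows "0 < y" "y < m" "y \<notin> RS" "y + m \<notin> RS" "y \<notin> B" "0 \<le> bal y" "bal y \<le> 2 - c" "c \<le> 2"
proof -
  show a: "0 < y" "y < m" "y \<notin> RS" "y + m \<notin> RS" using assms unfolding doubly_missing_def by auto
  show b: "y \<notin> B" using a not_in_B_if_missing by blast
  show d: "0 \<le> bal y" using a bal_missing by blast
  show "bal y \<le> 2 - c" using bal_missing_high[of y] bal_step[of y] a b by simp
  then show "c \<le> 2" using d by linarith
qed

text \<open>At a doubly missing \<open>y\<close> the pigeonhole has no room for a pair of opposite holes. Together with
\<open>double_pair\<close> this says that the reflection exchanges \<open>B\<close> and its complement, up to the centre.\<close>
lemma double_cover_low:
  assumes y: "doubly_missing y" and z: "0 \<le> z" "z \<le> y" shows "z \<in> B \<or> y - z \<in> B"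
proof (rule ccontr)
  assume neg: "\<not> ?thesis"
  note D = doubleD[OF y]
  have "y - 0 + 2 \<le> 2 * gaps (0 - 1) y"
  proof (rule reflection_count(2)[of _ _ z])
    fix z assume "z \<in> B" "0 + y - z \<in> B"
    then show "2 * z = 0 + y" using RS_I[of z "y - z"] D by (cases "z = y - z") auto
  qed (use D z neg in auto)
  then have "2 \<le> bal y" by (simp add: bal_def)
  then show False using D c_pos by linarith
qed

lemma double_cover_high:
  assumes y: "doubly_missing y" and z: "y \<le> z" "z \<le> m" shows "z \<in> B \<or> y + m - z \<in> B"
proof (rule ccontr)
  assume neg: "\<not> ?thesis"
  note D = doubleD[OF y]
  have "m - y + 2 \<le> 2 * gaps (y - 1) m"
  proof (rule reflection_count(2)[of _ _ z])
    fix z assume "z \<in> B" "y + m - z \<in> B"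
    then show "2 * z = y + m" using RS_I[of z "y + m - z"] D by (cases "z = y + m - z") auto
  qed (use D z neg in auto)
  moreover have "2 * gaps (y - 1) m = bal m - bal (y - 1) + (m - y + 1)"
    using gaps_bal[of "y - 1" m] D by simp
  moreover have "bal m = - c" using gaps_total m_eq by (simp add: bal_def)
  moreover have "bal y = bal (y - 1) + 1" using bal_step[of y] D by simp
  ultimately show False using D c_pos by linarith
qed

lemma double_pair: "doubly_missing y \<Longrightarrow> a \<in> B \<Longrightarrow> b \<in> B \<Longrightarrow> a + b = y \<or> a + b = y + m \<Longrightarrow> a = b"
  using RS_I[of a b] doubleD by metis

section \<open>At most two doubly missing residues\<close>

text \<open>The two reflections of \<open>[0, y]\<close> and \<open>[y, m]\<close> become a single one, \<open>z \<mapsto> y - z\<close>, on the \<open>m\<close>-periodic extension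
of \<open>B\<close>. Here \<open>0\<close> and \<open>m\<close> are identified, which is harmless as both are in \<open>B\<close>.\<close>
definition S :: "int \<Rightarrow> bool" where "S z \<longleftrightarrow> z mod m \<in> B"

lemma S_small: "0 \<le> z \<Longrightarrow> z < m \<Longrightarrow> S z \<longleftrightarrow> z \<in> B"
  by (simp add: S_def)

lemma S_cong: "m dvd z - z' \<Longrightarrow> S z \<longleftrightarrow> S z'"
  unfolding S_def by (simp add: mod_eq_dvd_iff[symmetric])

lemma double_S:
  assumes "doubly_missing y"
  shows "S z \<or> S (y - z)" and "S z \<Longrightarrow> S (y - z) \<Longrightarrow> m dvd 2 * z - y"
proof -
  note D = doubleD[OF assms]
  define a where "a = z mod m"
  have a: "0 \<le> a" "a < m" using m_pos by (auto simp: a_def)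
  have za: "m dvd z - a" by (simp add: a_def mod_eq_dvd_iff[symmetric])
  have Sz: "S z \<longleftrightarrow> a \<in> B" by (simp add: S_def a_def)
  define b where "b = (if a \<le> y then y - a else y + m - a)"
  have b: "0 \<le> b" "b < m" using a D by (auto simp: b_def)
  have "m dvd - (z - a) + (if a \<le> y then 0 else - m)" using za
    by (intro dvd_add) (simp_all add: dvd_diff_commute)
  moreover have "- (z - a) + (if a \<le> y then 0 else - m) = y - z - b" by (simp add: b_def)
  ultimately have "m dvd y - z - b" by (simp only:)
  then have Sy: "S (y - z) \<longleftrightarrow> b \<in> B" using S_cong[of "y - z" b] S_small[of b] b by simp
  show "S z \<or> S (y - z)"
    using double_cover_low[OF assms, of a] double_cover_high[OF assms, of a] a Sz Sy
    by (auto simp: b_def split: if_splits)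
  show "m dvd 2 * z - y" if "S z" "S (y - z)"
  proof -
    have "a = b" using double_pair[OF assms, of a b] that Sz Sy by (auto simp: b_def)
    then have "2 * a - y = 0 \<or> 2 * a - y = m" by (auto simp: b_def split: if_splits)
    then have "m dvd 2 * a - y" by (elim disjE) simp_all
    moreover have "m dvd 2 * (z - a)" using za by (rule dvd_mult)
    ultimately have "m dvd 2 * (z - a) + (2 * a - y)" by (rule dvd_add[rotated])
    moreover have "2 * (z - a) + (2 * a - y) = 2 * z - y" by simp
    ultimately show ?thesis by simp
  qed
qed

text \<open>For odd \<open>y\<close> a half modulo \<open>m\<close> exists because then the parity of the balance forces \<open>c = 1\<close>, so \<open>m\<close> is odd. A half
is fixed by the reflection, and of the two equal points at least one is covered.\<close>
lemma double_half:
  assumes "doubly_missing y" shows "\<exists>u. m dvd 2 * u - y \<and> S u"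
proof -
  note D = doubleD[OF assms]
  have "\<exists>u. m dvd 2 * u - y"
  proof (cases "even y")
    case True
    then have "2 * (y div 2) - y = 0" by simp
    then show ?thesis by (metis dvd_0_right)
  next
    case False
    then have "odd (bal y)" using bal_parity[of y] by simp
    then have "c = 1" using D c_pos by (cases "c = 2") auto
    then have "2 * ((y + m) div 2) - y = m" using False m_eq by simp
    then show ?thesis by (metis dvd_refl)
  qed
  then obtain u where u: "m dvd 2 * u - y" by blast
  have "S (y - u) \<longleftrightarrow> S u" 
  proof (rule S_cong)
    have "y - u - u = - (2 * u - y)" by simp
    then show "m dvd y - u - u" using u by (simp only: dvd_minus_iff)
  qed
  then show ?thesis using double_S(1)[OF assms, of u] u by blast
qed

text \<open>Let \<open>u\<close> be a half of \<open>r2\<close>. Reflecting \<open>u\<close> in \<open>r1\<close> and then in \<open>r0\<close> leads to the element \<open>u + r0 - r1\<close>; in the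
other order it leads to \<open>u + r1 - r0\<close>. These two elements add up to \<open>r2\<close>, so they must be equal modulo \<open>m\<close>.\<close>
lemma three_doubles:
  assumes "doubly_missing r0" "doubly_missing r1" "doubly_missing r2" "r2 \<noteq> r0" "r2 \<noteq> r1"
  shows "m dvd 2 * (r0 - r1)"
proof -
  obtain u where u: "m dvd 2 * u - r2" "S u" using double_half[OF assms(3)] by blast
  have ne: "\<not> m dvd 2 * u - r" if "doubly_missing r" "r2 \<noteq> r" for r
  proof
    assume "m dvd 2 * u - r"
    then have "m dvd (2 * u - r) - (2 * u - r2)" using u(1) by (rule dvd_diff)
    then have "m dvd r2 - r" by simp
    then have "r2 mod m = r mod m" by (simp add: mod_eq_dvd_iff)
    then show False using that doubleD[OF assms(3)] doubleD[OF that(1)] by simp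
  qed
  have "\<not> S (r1 - u)" using ne[of r1] assms double_S(2)[of r1 u] u by blast
  then have a: "S (r0 - (r1 - u))" using double_S(1)[OF assms(1), of "r1 - u"] by blast
  have "\<not> S (r0 - u)" using ne[of r0] assms double_S(2)[of r0 u] u by blast
  then have b: "S (r1 - (r0 - u))" using double_S(1)[OF assms(2), of "r0 - u"] by blast
  have "S (r2 - (r0 - (r1 - u))) \<longleftrightarrow> S (r1 - (r0 - u))"
  proof (rule S_cong)
    have "r2 - (r0 - (r1 - u)) - (r1 - (r0 - u)) = - (2 * u - r2)" by simp
    then show "m dvd r2 - (r0 - (r1 - u)) - (r1 - (r0 - u))" using u(1) by (simp only: dvd_minus_iff)
  qed
  then have "m dvd 2 * (r0 - (r1 - u)) - r2" using double_S(2)[OF assms(3) a] b by blast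
  then have "m dvd (2 * (r0 - (r1 - u)) - r2) - (2 * u - r2)" using u(1) by (rule dvd_diff)
  moreover have "(2 * (r0 - (r1 - u)) - r2) - (2 * u - r2) = 2 * (r0 - r1)" by simp
  ultimately show ?thesis by simp
qed

text \<open>By the previous lemma any two of three doubly missing numbers in \<open>(0, m)\<close> would differ by exactly \<open>m / 2\<close>.\<close>
lemma card_doubles: "card {y. doubly_missing y} \<le> 2"
proof (rule ccontr)
  assume "\<not> ?thesis"
  then have "3 \<le> card {y. doubly_missing y}" by simp
  then obtain T where T: "T \<subseteq> {y. doubly_missing y}" "card T = 3" by (meson obtain_subset_with_card_n)
  then obtain p q r where pqr: "T = {p, q, r}" "p \<noteq> q" "q \<noteq> r" "p \<noteq> r" by (meson card_3_iff)
  then have d: "doubly_missing p" "doubly_missing q" "doubly_missing r" using T by auto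
  have k: "\<bar>a - b\<bar> * 2 = m" if ab: "m dvd 2 * (a - b)" "doubly_missing a" "doubly_missing b" "a \<noteq> b" for a b
  proof -
    obtain j where j: "2 * (a - b) = m * j" using ab(1) by (rule dvdE)
    have lt: "a - b < m" "b - a < m" using doubleD(1,2)[OF ab(2)] doubleD(1,2)[OF ab(3)] by linarith+
    have "j < 2"
    proof (rule ccontr)
      assume "\<not> j < 2"
      then have "m * 2 \<le> m * j" using m_pos by (intro mult_left_mono) linarith+
      then show False unfolding j[symmetric] using lt by (simp add: algebra_simps)
    qed
    moreover have "-2 < j"
    proof (rule ccontr)
      assume "\<not> -2 < j"
      then have "m * j \<le> m * (-2)" using m_pos by (intro mult_left_mono) linarith+
      then show False unfolding j[symmetric] using lt by (simp add: algebra_simps)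
    qed
    moreover have "j \<noteq> 0" using j ab(4) by (metis eq_iff_diff_eq_0 mult_eq_0_iff zero_neq_numeral)
    ultimately consider "j = 1" | "j = -1" by linarith
    then show ?thesis
    proof cases
      case 1
      then have "2 * (a - b) = m" using j by simp
      then show ?thesis using m_pos by (simp add: abs_if)
    next
      case 2
      then have "2 * (a - b) = - m" using j by simp
      then show ?thesis using m_pos by (simp add: abs_if)
    qed
  qed
  have "\<bar>p - q\<bar> * 2 = m" using k[OF three_doubles[of p q r]] d pqr by simp
  moreover have "\<bar>q - r\<bar> * 2 = m" using k[OF three_doubles[of q r p]] d pqr by simp
  moreover have "\<bar>p - r\<bar> * 2 = m" using k[OF three_doubles[of p r q]] d pqr by simp
  ultimately show False using m_pos by (smt (verit))
qed

end

section \<open>Rich holes from translation by the last gap\<close>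

text \<open>The set \<open>A\<close> is \<open>B\<close> with \<open>m + w\<close> added; \<open>[x, m)\<close> is the window of length \<open>w\<close> at the top of \<open>B\<close>.\<close>
locale dense_block_end = dense_block +
  fixes t w x :: int
  assumes t_nonneg: "0 \<le> t" and w_eq: "w = c + t + 2" and x_eq: "x = m - w"
begin

text \<open>A hole \<open>v\<close> is rich if \<open>v\<close> and \<open>v + m\<close> are both restricted sums of \<open>A\<close>, and poor if neither is: the
number \<open>v + m\<close> is such a sum if it is one for \<open>B\<close> or if it equals \<open>b + (m + w)\<close> with \<open>b = v - w\<close>.\<close>
definition rich :: "int set" where
  "rich = {v \<in> {1..<m} - B. v \<in> RS \<and> (v + m \<in> RS \<or> v - w \<in> B)}"

definition poor :: "int set" where
  "poor = {v \<in> {1..<m} - B. v \<notin> RS \<and> v + m \<notin> RS \<and> v - w \<notin> B}"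

text \<open>These are the holes that translation by \<open>w\<close> reaches above the window \<open>(p, p + w]\<close> but that fail to be
rich, because they are not sums themselves.\<close>
definition loss :: "int \<Rightarrow> int set" where
  "loss p = {s \<in> {1..<m}. s \<notin> RS \<and> p + w < s \<and> s - w \<in> B}"

lemma x_val: "x = 2 * h - 2 - t" using x_eq w_eq m_eq by simp

lemma w_pos: "3 \<le> w" using w_eq t_nonneg c_pos by simp

lemma finite_sets: "finite rich" "finite poor" "finite (loss p)"
  unfolding rich_def poor_def loss_def by (rule finite_subset[of _ "{1..<m}"]; auto)+

lemma poor_double: "y \<in> poor \<Longrightarrow> doubly_missing y"
  unfolding poor_def doubly_missing_def by auto

lemma top_gaps:
  assumes "0 \<le> x" shows "2 * gaps (x - 1) (m - 1) = t + 3 - bal (x - 1)"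
  using gaps_bal[of "x - 1" "m - 1"] bal_last assms x_eq w_eq w_pos by simp

text \<open>Translation by \<open>w\<close> maps \<open>(p, x)\<close> onto \<open>(p + w, m)\<close>. The surplus of holes in the latter interval equals the surplus of the
top window over \<open>(p, p + w]\<close>, so at least that many holes lie \<open>w\<close> above an element of \<open>B\<close>. Each of them is rich or a loss.
Rich holes inside \<open>(p, p + w]\<close> may be discounted from that window as well.\<close>
lemma chain:
  assumes p: "-1 \<le> p" "p \<le> x - 1"
  shows "gaps (x - 1) (m - 1) \<le> int (card (({p<..p + w} - B) - rich)) + int (card rich) + int (card (loss p))"
proof -
  define K where "K = {v \<in> {p + w<..m - 1} - B. v - w \<in> B}"
  define K' where "K' = {v \<in> {p + w<..m - 1} - B. v - w \<notin> B}"
  define J where "J = ({p<..p + w} - B) \<inter> rich"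
  have fin: "finite K" "finite K'" "finite J"
    by (rule finite_subset[of _ "{p<..m - 1} \<union> rich"]; use w_pos finite_sets in \<open>auto simp: K_def K'_def J_def\<close>)+
  have "{p + w<..m - 1} - B = K \<union> K'" unfolding K_def K'_def by auto
  moreover have "card (K \<union> K') = card K + card K'"
    by (rule card_Un_disjoint) (use fin in \<open>auto simp: K_def K'_def\<close>)
  ultimately have g1: "gaps (p + w) (m - 1) = int (card K) + int (card K')"
    unfolding gaps_def by simp
  have "card K' \<le> card ({p<..x - 1} - B)"
  proof (rule card_inj_on_le)
    show "inj_on (\<lambda>v. v - w) K'" by (auto simp: inj_on_def)
    show "(\<lambda>v. v - w) ` K' \<subseteq> {p<..x - 1} - B" unfolding K'_def using x_eq by auto
  qed auto
  then have g2: "int (card K') \<le> gaps p (x - 1)" by (simp add: gaps_def)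
  have "card ({p<..p + w} - B) = card J + card (({p<..p + w} - B) - rich)"
    unfolding J_def by (rule card_Int_Diff) auto
  then have g3: "gaps p (p + w) = int (card J) + int (card (({p<..p + w} - B) - rich))"
    unfolding gaps_def by simp
  have g4: "gaps p (p + w) + gaps (p + w) (m - 1) = gaps p (x - 1) + gaps (x - 1) (m - 1)"
    using gaps_split[of p "p + w" "m - 1"] gaps_split[of p "x - 1" "m - 1"] p x_eq w_pos by simp
  have "K \<union> J \<subseteq> rich \<union> loss p"
  proof -
    have "v \<in> rich \<union> loss p" if "v \<in> K" for v
      using that p w_pos unfolding K_def rich_def loss_def by auto
    then show ?thesis unfolding J_def by auto
  qed
  then have "card (K \<union> J) \<le> card (rich \<union> loss p)" by (intro card_mono) (auto simp: finite_sets)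
  also have "\<dots> \<le> card rich + card (loss p)" by (rule card_Un_le)
  also have "card (K \<union> J) = card K + card J"
    by (rule card_Un_disjoint) (use fin in \<open>auto simp: K_def J_def\<close>)
  finally show ?thesis using g1 g2 g3 g4 by linarith
qed

lemma chain_gaps:
  assumes p: "-1 \<le> p" "p \<le> x - 1"
  shows "gaps (x - 1) (m - 1) \<le> gaps p (p + w) + int (card rich) + int (card (loss p))"
proof -
  have "card (({p<..p + w} - B) - rich) \<le> card ({p<..p + w} - B)" by (intro card_mono) auto
  then show ?thesis using chain[OF p] by (simp add: gaps_def)
qed

lemma last_nonneg:
  assumes "1 \<le> x" obtains p where "0 \<le> p" "p \<le> x - 1" "0 \<le> bal p" "\<And>i. p < i \<Longrightarrow> i \<le> x - 1 \<Longrightarrow> bal i < 0"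
proof -
  define T where "T = {i \<in> {0..x - 1}. 0 \<le> bal i}"
  have T: "finite T" unfolding T_def by (rule finite_subset[of _ "{0..x - 1}"]) auto
  have "0 \<in> T" using assms bal_zero unfolding T_def by simp
  then have ne: "T \<noteq> {}" by blast
  have "Max T \<in> T" using T ne by (rule Max_in)
  moreover have "bal i < 0" if "Max T < i" "i \<le> x - 1" for i
  proof (rule ccontr)
    assume "\<not> bal i < 0"
    then have "i \<in> T" using that \<open>Max T \<in> T\<close> unfolding T_def by auto
    then show False using Max_ge[OF T] that by force
  qed
  ultimately show thesis using that unfolding T_def by auto
qed

text \<open>The walk cannot climb high inside the top window: up to \<open>v\<close> it gains at most 1 per step, and on the other
hand \<open>bal v \<le> 2 h - v\<close> because there are only \<open>h\<close> holes. The claim is the sum of the two bounds.\<close>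
lemma bal_top:
  assumes "1 \<le> x" "x \<le> v" "v \<le> m" shows "2 * bal v \<le> t + 3 + bal (x - 1)"
  using bal_up[of "x - 1" v] bal_le[of v] assms x_val by linarith

lemma balance_parity: "odd (bal (x - 1) + t)"
  using bal_parity[of "x - 1"] x_val by simp

section \<open>At most one poor hole\<close>

text \<open>After its last nonnegative value at \<open>p\<close> the walk stays negative up to \<open>m\<close>, so all later \<open>v\<close> are sums and there
is no loss. A hole in \<open>(p, p + w]\<close> that is not rich has \<open>v + m\<close> missing, and from \<open>p\<close> the walk needs at least \<open>c - 1\<close>
steps to come down to \<open>1 - c\<close>; this leaves only \<open>t + 3\<close> places.\<close>
lemma card_rich_ge:
  assumes x: "1 \<le> x" and f: "bal (x - 1) \<le> - t - 4"
  shows "- bal (x - 1) - t - 3 \<le> 2 * int (card rich)"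
proof -
  obtain p where p: "0 \<le> p" "p \<le> x - 1" "0 \<le> bal p" "\<And>i. p < i \<Longrightarrow> i \<le> x - 1 \<Longrightarrow> bal i < 0"
    using last_nonneg[OF x] by blast
  have neg: "bal v < 0" if "p < v" "v < m" for v
    using bal_top[OF x, of v] p(4)[of v] that f by (cases "v \<le> x - 1") auto
  have RSv: "v \<in> RS" if "p < v" "v < m" for v
    using neg[OF that] bal_missing[of v] p that by fastforce
  have "loss p = {}" using RSv w_pos unfolding loss_def by force
  moreover have "({p<..p + w} - B) - rich \<subseteq> {p + c..p + w}"
  proof
    fix v assume v: "v \<in> ({p<..p + w} - B) - rich"
    then have vm: "0 < v" "p < v" "v < m" using p x_eq w_pos by auto
    then have "v + m \<notin> RS" using v RSv unfolding rich_def by auto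
    then have "bal (v - 1) \<le> 1 - c" using bal_missing_high vm by simp
    moreover have "bal p - (v - 1 - p) \<le> bal (v - 1)" using bal_down[of p "v - 1"] p vm by simp
    ultimately show "v \<in> {p + c..p + w}" using p v by auto
  qed
  then have "card (({p<..p + w} - B) - rich) \<le> card {p + c..p + w}" by (intro card_mono) auto
  moreover have "int (card {p + c..p + w}) = t + 3" using w_eq t_nonneg by simp
  ultimately have "int (card (({p<..p + w} - B) - rich)) \<le> t + 3" by linarith
  moreover have "gaps (x - 1) (m - 1) \<le> int (card (({p<..p + w} - B) - rich)) + int (card rich)"
    using chain[of p] p \<open>loss p = {}\<close> by simp
  moreover have "2 * gaps (x - 1) (m - 1) = t + 3 - bal (x - 1)" using top_gaps x by simp
  ultimately show ?thesis by linarith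
qed

text \<open>With the same \<open>p\<close>, the walk is lower at \<open>p + w\<close> than at \<open>p\<close>, so at most \<open>(w - 1) / 2\<close> of \<open>(p, p + w]\<close> are holes. For
\<open>c \<le> 2\<close> these are at most \<open>(t + 3) / 2\<close>, few enough to afford the single loss \<open>2 h\<close> that can occur.\<close>
lemma card_rich_ge_small_c:
  assumes x: "1 \<le> x" and f: "bal (x - 1) \<le> - t - 3" and c2: "c \<le> 2"
  shows "- bal (x - 1) - t - 1 \<le> 2 * int (card rich)"
proof -
  obtain p where p: "0 \<le> p" "p \<le> x - 1" "0 \<le> bal p" "\<And>i. p < i \<Longrightarrow> i \<le> x - 1 \<Longrightarrow> bal i < 0"
    using last_nonneg[OF x] by blast
  have pf: "p \<le> x - 1 + bal (x - 1)" using bal_down[of p "x - 1"] p by simp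
  have loss: "loss p \<subseteq> (if bal (x - 1) = - t - 3 then {2 * h} else {})"
  proof
    fix s assume s: "s \<in> loss p"
    then have b: "0 \<le> bal s" "0 < s" "s < m" "p < s" using bal_missing w_pos unfolding loss_def by auto
    then have "x \<le> s" using p(4)[of s] by force
    then have "2 * bal s \<le> t + 3 + bal (x - 1)" using bal_top[OF x] b by simp
    then have e: "bal s = 0" "bal (x - 1) = - t - 3" using b f by linarith+
    then have "s = 2 * h" using bal_up[of "x - 1" s] bal_le[of s] x x_val \<open>x \<le> s\<close> b by simp
    then show "s \<in> (if bal (x - 1) = - t - 3 then {2 * h} else {})" using e by simp
  qed
  have "card (loss p) \<le> card (if bal (x - 1) = - t - 3 then {2 * h} else {})"
    using loss by (intro card_mono) auto
  then have l: "int (card (loss p)) \<le> (if bal (x - 1) = - t - 3 then 1 else 0)" by (auto split: if_splits)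
  have "bal (p + w) < 0"
  proof (cases "p + w \<le> x - 1")
    case True
    then show ?thesis using p(4)[of "p + w"] w_pos by simp
  next
    case False
    have "bal (p + w) \<le> bal (x - 1) + (p + w - (x - 1))" using bal_up[of "x - 1" "p + w"] False x by simp
    then show ?thesis using pf f w_eq c2 t_nonneg by linarith
  qed
  then have "2 * gaps p (p + w) \<le> w - 1" using gaps_bal[of p "p + w"] p w_pos by simp
  moreover have "gaps (x - 1) (m - 1) \<le> gaps p (p + w) + int (card rich) + int (card (loss p))"
    using chain_gaps[of p] p by simp
  moreover have "2 * gaps (x - 1) (m - 1) = t + 3 - bal (x - 1)" using top_gaps x by simp
  ultimately show ?thesis using l f w_eq c2 t_nonneg by (auto split: if_splits)
qed

end


context dense_block_end
begin

section \<open>Two poor holes\<close>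

lemma poorD:
  assumes "y \<in> poor"
  shows "doubly_missing y" "y - w \<notin> B" "y \<noteq> w"
  using assms zero_in poor_double unfolding poor_def by auto

lemma poor_left:
  assumes "y \<in> poor" "y < x" shows "y \<le> x - 1 + bal (x - 1)"
  using bal_down[of y "x - 1"] doubleD(1,6)[OF poorD(1)[OF assms(1)]] assms(2) by linarith

lemma poor_right:
  assumes "y \<in> poor" "x \<le> y" "1 \<le> x" shows "x - 1 - bal (x - 1) \<le> y" "y \<le> 2 * h"
  using bal_up[of "x - 1" y] bal_le[of y] doubleD(1,2,6)[OF poorD(1)[OF assms(1)]] assms(2,3)
  by linarith+

lemma w_in_if_poor: "y \<in> poor \<Longrightarrow> w < y \<Longrightarrow> w \<in> B"
  using double_cover_low[of y w] poorD[of y] w_pos by auto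

text \<open>Once \<open>w \<in> B\<close>, a number \<open>s\<close> with \<open>s - w \<in> B\<close> is the sum \<open>w + (s - w)\<close> unless \<open>s = 2 w\<close>. So losses practically disappear.\<close>
lemma lossD:
  assumes "w \<in> B" "s \<in> loss p"
  shows "s = 2 * w" "p < w" "s \<notin> RS" "s \<notin> B" "s < m" "s \<le> 2 * h"
proof -
  have s: "1 \<le> s" "s < m" "s \<notin> RS" "p + w < s" "s - w \<in> B" using assms(2) unfolding loss_def by auto
  show e: "s = 2 * w" using RS_I[of w "s - w"] assms(1) s by (cases "w = s - w") auto
  show "p < w" using e s by linarith
  show "s \<notin> RS" "s < m" using s by auto
  show "s \<notin> B" using not_in_B_if_missing[of s] s by auto
  show "s \<le> 2 * h" using bal_missing[of s] bal_le[of s] s by linarith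
qed

lemma card_loss: "w \<in> B \<Longrightarrow> card (loss p) \<le> 1"
  using card_mono[of "{2 * w}" "loss p"] lossD(1) by auto

lemma loss_empty: "w \<in> B \<Longrightarrow> w \<le> p \<Longrightarrow> card (loss p) = 0"
  using lossD(2)[of _ p] by fastforce

lemma top_count:
  assumes "1 \<le> x" shows "int (card ({x - 1<..m - 1} \<inter> B)) = w - gaps (x - 1) (m - 1)"
  using gaps_add_card[of "x - 1" "m - 1"] w_pos x_eq by simp

text \<open>The reflection in \<open>y\<close> maps \<open>(y, y + w]\<close> onto the top window, sending holes to elements. If the top
window has many holes, the window after \<open>y\<close> therefore has few.\<close>
lemma mirror_bound:
  assumes y: "y \<in> poor" "y < x"
  shows "1 - c - bal (x - 1) \<le> int (card rich) + int (card (loss y))"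
proof -
  note D = doubleD[OF poorD(1)[OF y(1)]]
  have "card ({y<..y + w} - B) \<le> card ({x - 1<..m - 1} \<inter> B)"
  proof (rule card_inj_on_le)
    show "inj_on (\<lambda>z. y + m - z) ({y<..y + w} - B)" by (auto simp: inj_on_def)
    show "(\<lambda>z. y + m - z) ` ({y<..y + w} - B) \<subseteq> {x - 1<..m - 1} \<inter> B"
    proof
      fix v assume "v \<in> (\<lambda>z. y + m - z) ` ({y<..y + w} - B)"
      then obtain z where z: "v = y + m - z" "y < z" "z \<le> y + w" "z \<notin> B" by auto
      then show "v \<in> {x - 1<..m - 1} \<inter> B"
        using double_cover_high[OF poorD(1)[OF y(1)], of z] y(2) x_eq by auto
    qed
  qed auto
  then have "gaps y (y + w) \<le> w - gaps (x - 1) (m - 1)"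
    using top_count y D by (simp add: gaps_def)
  then show ?thesis using chain_gaps[of y] y D top_gaps w_eq by simp
qed

lemma double_c2:
  assumes "c = 2" "doubly_missing y" shows "bal y = 0" "even y"
proof -
  show b: "bal y = 0" using doubleD(6,7)[OF assms(2)] assms(1) by simp
  then show "even y" using bal_parity[of y] by simp
qed

lemma gaps4: "gaps a (a + 4) = gaps a (a + 1) + gaps (a + 1) (a + 2) + gaps (a + 2) (a + 3) + gaps (a + 3) (a + 4)"
  using gaps_split[of a "a + 1" "a + 4"] gaps_split[of "a + 1" "a + 2" "a + 4"] gaps_split[of "a + 2" "a + 3" "a + 4"]
  by simp

lemma gaps_succ: "b = a + 1 \<Longrightarrow> gaps a b = (if b \<in> B then 0 else 1)"
  using gaps_unit[of b] by simp

text \<open>Only one of the three numbers \<open>2 h - 1\<close>, \<open>2 h\<close>, \<open>2 h + 1\<close> is a hole, because the walk goes from \<open>0\<close> to \<open>-1\<close> over them.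
If it is the middle one, the outer two have sum \<open>(2 h - 2) + m\<close>, which was assumed missing.\<close>
lemma near_top:
  assumes "c = 2" "doubly_missing (2 * h - 2)" "2 * h \<notin> B" shows False
proof -
  have h: "0 < 2 * h - 2" using doubleD(1)[OF assms(2)] .
  have b0: "bal (2 * h - 2) = 0" using double_c2(1)[OF assms(1,2)] .
  have b3: "bal (2 * h + 1) = -1" using bal_last m_eq assms(1) by (simp add: add.commute)
  have s1: "bal (2 * h - 1) = (if 2 * h - 1 \<in> B then -1 else 1)"
    using bal_step[of "2 * h - 1"] b0 h by simp
  have s2: "bal (2 * h) = bal (2 * h - 1) + 1" using bal_step[of "2 * h"] assms(3) h by simp
  have s3: "bal (2 * h + 1) = bal (2 * h) + (if 2 * h + 1 \<in> B then -1 else 1)"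
    using bal_step[of "2 * h + 1"] h by simp
  have "2 * h - 1 \<in> B" "2 * h + 1 \<in> B" using s1 s2 s3 b3 by (auto split: if_splits)
  then show False using double_pair[OF assms(2), of "2 * h - 1" "2 * h + 1"] m_eq assms(1) by simp
qed

text \<open>Both poor holes in the top window. The balance leaves only the three places \<open>2 h - 2\<close>, \<open>2 h - 1\<close>, \<open>2 h\<close>. The surviving
case is that of two consecutive ones: composing their reflections gives translation by 1, so \<open>B\<close>
contains with \<open>w\<close> everything below it, and the first window \<open>[0, w)\<close> has no holes at all.\<close>
lemma two_poor_right:
  assumes x: "1 \<le> x" and f: "bal (x - 1) \<le> - t - 1"
    and y: "y1 \<in> poor" "y2 \<in> poor" "y1 < y2" "x \<le> y1"
  shows "- bal (x - 1) - t + 1 \<le> 2 * int (card rich)"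
proof -
  note d1 = poorD[OF y(1)] and d2 = poorD[OF y(2)]
  note D1 = doubleD[OF d1(1)] and D2 = doubleD[OF d2(1)]
  have lo: "x - 1 - bal (x - 1) \<le> y1" and hi: "y2 \<le> 2 * h"
    using poor_right[of y1] poor_right[of y2] x y by auto
  have ft: "bal (x - 1) = - t - 1"
  proof -
    have "- bal (x - 1) < t + 3" using lo hi y(3) x_val by linarith
    moreover obtain k where "bal (x - 1) + t = 2 * k + 1" using balance_parity by (rule oddE)
    ultimately show ?thesis using f by presburger
  qed
  have y1ge: "2 * h - 2 \<le> y1" using lo ft x_val by simp
  have top: "bal (2 * h) \<le> 0" using bal_le[of "2 * h"] h_nonneg m_eq c_pos by simp
  have h1: "1 \<le> h" using x x_val t_nonneg by simp
  have lowtop: "bal (2 * h - 1) \<le> 1" using bal_le[of "2 * h - 1"] h1 m_eq c_pos by simp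
  have y1: "y1 = 2 * h - 2"
  proof (rule ccontr)
    assume "y1 \<noteq> 2 * h - 2"
    then have e: "y1 = 2 * h - 1" "y2 = 2 * h" using y1ge hi y(3) by linarith+
    have "bal y1 \<noteq> 0" using bal_parity[of y1] e by auto
    then have "1 \<le> bal y1" using D1(6) by linarith
    moreover have "bal y2 = bal y1 + 1" using bal_step[of y2] D2(1,5) e by simp
    ultimately show False using top e by simp
  qed
  have x2: "2 \<le> x"
  proof (rule ccontr)
    assume "\<not> 2 \<le> x"
    then have "x = 1" using x by simp
    then show False using f t_nonneg bal_zero by simp
  qed
  consider "c = 2" | "c = 1" using D1(8) c_pos by linarith
  then show ?thesis
  proof cases
    case 1
    have "even y2" using double_c2[OF 1 d2(1)] by simp
    then have "y2 = 2 * h" using y1 y(3) hi y1ge by presburger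
    then show ?thesis using near_top[OF 1] d1(1) D2(5) y1 by simp
  next
    case 2
    consider (consecutive) "y2 = 2 * h - 1" | (last) "y2 = 2 * h" using y(3) y1 hi by linarith
    then show ?thesis
    proof cases
      case consecutive
      \<comment> \<open>The composition of the reflections in \<open>y2\<close> and \<open>y1 = y2 - 1\<close>; there is no fixed point as \<open>y2\<close> is odd.\<close>
      have pred: "z - 1 \<in> B" if "z \<in> B" "1 \<le> z" "z \<le> y2" for z
      proof -
        have "y2 - z \<notin> B"
        proof
          assume "y2 - z \<in> B"
          then have "z = y2 - z" using double_pair[OF d2(1), of z "y2 - z"] that by simp
          then show False using consecutive by presburger
        qed
        then show ?thesis using double_cover_low[OF d1(1), of "z - 1"] that consecutive y1 by (simp add: algebra_simps)
      qed
      have wy: "w < y2" using d2(3) x2 w_eq x_val consecutive 2 by linarith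
      have w_in: "w \<in> B" using w_in_if_poor[OF y(2) wy] .
      have all: "w - int j \<in> B" if "int j \<le> w" for j
        using that
      proof (induction j)
        case 0
        then show ?case using w_in by simp
      next
        case (Suc j)
        then have "w - int j - 1 \<in> B" using pred[of "w - int j"] wy by simp
        then show ?case by (simp add: algebra_simps)
      qed
      have "{-1<..-1 + w} - B = {}"
      proof -
        have "z \<in> B" if "0 \<le> z" "z < w" for z using all[of "nat (w - z)"] that by simp
        then show ?thesis by auto
      qed
      then have "gaps (-1) (-1 + w) = 0" unfolding gaps_def by simp
      then have "gaps (x - 1) (m - 1) \<le> int (card rich) + 1"
        using chain_gaps[of "-1"] card_loss[OF w_in, of "-1"] x by simp
      then show ?thesis using top_gaps x ft t_nonneg by simp
    next
      case last
      have m1: "m = 2 * h + 1" using m_eq 2 by simp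
      have xm: "x - 1 \<notin> B" 
      proof -
        have "y2 - w = x - 1" using last x_eq m1 by linarith
        then show ?thesis using d2(2) by simp
      qed
      have "bal y1 = 0" using bal_parity[of y1] D1(6,7) 2 y1 by (cases "bal y1 = 1") auto
      then have "bal (2 * h - 1) = (if 2 * h - 1 \<in> B then -1 else 1)"
        using bal_step[of "2 * h - 1"] y1 h1 by simp
      moreover have "bal (2 * h) = bal (2 * h - 1) + 1" using bal_step[of "2 * h"] D2(5) last h1 by simp
      ultimately have h1in: "2 * h - 1 \<in> B" using top by (auto split: if_splits)
      have "1 \<notin> B"
      proof
        assume "1 \<in> B"
        then have "1 = 2 * h - 1" using double_pair[OF d2(1) _ h1in, of 1] last by simp
        then show False using y1 D1(1) by simp
      qed
      then have y1p: "y1 - 1 \<in> B" using double_cover_low[OF d1(1), of 1] D1(1) by simp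
      have "y1 - 1 \<notin> B"
      proof (cases "t = 0")
        case True
        then have "y1 - 1 = x - 1" using y1 x_val by simp
        then show ?thesis using xm by simp
      next
        case False
        then show ?thesis using climbing_run_avoids_B[of "x - 1" y1 "y1 - 1"] \<open>bal y1 = 0\<close> ft y1 x_val x t_nonneg by simp
      qed
      then show ?thesis using y1p by simp
    qed
  qed
qed

end

context dense_block_end
begin

text \<open>Reflecting \<open>w\<close> in a poor hole \<open>y > w\<close> shows \<open>w \<in> B\<close> at once. If both poor holes lie below \<open>w\<close> and \<open>w \<notin> B\<close>,
their reflections put \<open>x + y1\<close> and \<open>x + y2\<close> into the top window, which holds at most \<open>c\<close> elements. So
\<open>c = 2\<close> and these are the only two, which determines the window after \<open>y1\<close> completely: it has just
the holes \<open>y2 = y1 + 2\<close> and \<open>w = y1 + 4\<close>. The reflection in \<open>y2\<close> contradicts this.\<close>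
lemma w_in_two_poor:
  assumes x: "1 \<le> x" and f: "bal (x - 1) \<le> - t - 1"
    and y: "y1 \<in> poor" "y2 \<in> poor" "y1 < y2" "y1 < x"
  shows "w \<in> B"
proof (rule ccontr)
  assume wB: "w \<notin> B"
  note d1 = poorD[OF y(1)] and d2 = poorD[OF y(2)]
  note D1 = doubleD[OF d1(1)] and D2 = doubleD[OF d2(1)]
  have y2w: "y2 < w" using w_in_if_poor[OF y(2)] d2(3) wB by linarith
  have xy: "x + y1 \<in> B" "x + y2 \<in> B"
    using double_cover_high[OF d1(1), of w] double_cover_high[OF d2(1), of w] wB y y2w x x_eq
    by (auto simp: algebra_simps)
  have cnt: "int (card ({x - 1<..m - 1} \<inter> B)) \<le> c"
    using top_count[OF x] top_gaps x f w_eq by linarith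
  have sub: "{x + y1, x + y2} \<subseteq> {x - 1<..m - 1} \<inter> B" using xy D1(1) D2(1) y y2w x_eq by auto
  have two: "card {x + y1, x + y2} = 2" using y(3) by simp
  have fin: "finite ({x - 1<..m - 1} \<inter> B)" by simp
  have "2 \<le> c" using card_mono[OF fin sub] two cnt by linarith
  then have c2: "c = 2" using D1(8) by simp
  have eq: "{x - 1<..m - 1} \<inter> B = {x + y1, x + y2}"
    using card_seteq[OF fin sub] two cnt c2 by simp
  have ev: "even y1" "even y2" "bal y1 = 0" "bal y2 = 0" using double_c2[OF c2] d1(1) d2(1) by auto
  \<comment> \<open>The reflection in \<open>y1\<close> carries the description of the top window over to the window after \<open>y1\<close>.\<close>
  have hole: "i = w - y1 \<or> i = w - y2" if "1 \<le> i" "i \<le> w" "y1 + i \<notin> B" for i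
  proof -
    have "y1 + i \<in> B \<or> y1 + m - (y1 + i) \<in> B" using double_cover_high[OF d1(1), of "y1 + i"] that y(4) x_eq by simp
    then have "m - i \<in> B" using that by simp
    then have "m - i \<in> {x + y1, x + y2}" using eq[symmetric] that x_eq by simp
    then show ?thesis using x_eq by auto
  qed
  have ww: "w = 2 * y2 - y1" using hole[of "y2 - y1"] D1(1) D2(5) y2w y(3) by auto
  have run: "{y1<..y2 - 1} - B = {}"
  proof -
    have "z \<in> B" if "y1 < z" "z < y2" for z
      using hole[of "z - y1"] that ww D1(1) y2w by auto
    then show ?thesis by auto
  qed
  have "gaps y1 (y2 - 1) = 0" unfolding gaps_def run by simp
  moreover have "bal (y2 - 1) = -1" using bal_step[of y2] D2 ev by simp
  ultimately have y2e: "y2 = y1 + 2" using gaps_bal[of y1 "y2 - 1"] ev y(3) D1(1) by simp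
  have t1: "t = y1" using ww y2e w_eq c2 by simp
  have y1g: "2 \<le> y1" using D1(1) ev(1) by presburger
  \<comment> \<open>Since \<open>w = y1 + 4 \<ge> 6\<close>, the offset 6 is within the window, where the holes have offsets 2 and 4.\<close>
  have "y1 + 6 \<in> B" using hole[of 6] ww y2e y1g by auto
  then have "y1 + 6 = x + y1" using double_pair[OF d2(1) _ xy(1)] y2e x_eq ww by auto
  then have x6: "x = 6" by simp
  show False
  proof (cases "y2 < x")
    case True
    then show ?thesis using poor_left[OF y(2) True] f y2e t1 y1g x6 by simp
  next
    case False
    then show ?thesis using poor_right(1)[OF y(2) _ x] f y2e t1 x6 by simp
  qed
qed

text \<open>Here \<open>w = 3\<close>, and the loss of \<open>2 w = 6\<close> exactly spoils the reflection bound at \<open>y1 \<le> 2\<close>. If \<open>y2\<close> lies below the top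
window it can replace \<open>y1\<close>. Otherwise \<open>y1 = 2\<close> is contradictory, and for \<open>y1 = 1\<close> the midpoint \<open>(1 + m) / 2 = h + 1\<close>
is in \<open>B\<close> and the window of length 3 around it is mapped to itself, so it has at most one hole. It starts high enough to
avoid the loss unless \<open>m = 7\<close>, where \<open>y2\<close> finds no place.\<close>
lemma two_poor_c1_t0:
  assumes x: "1 \<le> x" and f: "bal (x - 1) = -1" and ct: "c = 1" "t = 0"
    and y: "y1 \<in> poor" "y2 \<in> poor" "y1 < y2" "y1 < x"
    and wB: "w \<in> B" and ls: "2 * w \<in> loss y1"
  shows "1 \<le> card rich"
proof -
  note d1 = poorD[OF y(1)] and d2 = poorD[OF y(2)]
  note D1 = doubleD[OF d1(1)] and D2 = doubleD[OF d2(1)]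
  have w3: "w = 3" using w_eq ct by simp
  have B3: "3 \<in> B" using wB w3 by simp
  have L: "y1 < 3" "6 \<notin> B" "6 < m" "6 \<le> 2 * h" using lossD[OF wB ls] w3 by auto
  have m1: "m = 2 * h + 1" using m_eq ct by simp
  have xv: "x = 2 * h - 2" using x_val ct by simp
  have xm: "x = m - 3" using x_eq w3 by simp
  show ?thesis
  proof (cases "y2 < x")
    case True
    show ?thesis
    proof (cases "3 < y2")
      case True
      then have "card (loss y2) = 0" using loss_empty[OF wB, of y2] w3 by simp
      then show ?thesis using mirror_bound[OF y(2) \<open>y2 < x\<close>] f ct by simp
    next
      case False
      then have "y1 = 1" "y2 = 2" using d2(3) w3 y(3) D1(1) by linarith+
      then have "bal 2 = 2" using bal_step[of 1] bal_step[of 2] bal_zero D1(5) D2(5) by simp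
      then show ?thesis using D2(7) \<open>y2 = 2\<close> ct by simp
    qed
  next
    case right: False
    consider "y1 = 1" | "y1 = 2" using L(1) D1(1) by linarith
    then show ?thesis
    proof cases
      case 2
      have one: "1 \<in> B" using double_cover_low[OF d1(1), of 1] 2 by simp
      have m4: "m - 4 \<in> B" using double_cover_high[OF d1(1), of 6] 2 L by simp
      consider "y2 = m - 1" | "y2 = m - 2" | "y2 = m - 3" using right xm D2(2) by linarith
      then have False
      proof cases
        case 1
        then show ?thesis using d2(2) m4 w3 by simp
      next
        case a: 2
        have "m - 1 \<in> B" using double_cover_high[OF d2(1), of "m - 1"] a by simp
        then show ?thesis using double_pair[OF d1(1) B3, of "m - 1"] 2 L by simp
      next
        case 3
        then show ?thesis using double_pair[OF d2(1) one m4] L by simp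
      qed
      then show ?thesis ..
    next
      case 1
      have q: "h + 1 \<in> B" using double_cover_high[OF d1(1), of "h + 1"] 1 m1 h_nonneg by simp
      have pr: "h \<in> B \<or> h + 2 \<in> B" using double_cover_high[OF d1(1), of h] 1 m1 L by simp
      show ?thesis
      proof (cases "h \<le> 3")
        case True
        then have h3: "h = 3" using L m1 by simp
        have b3: "bal 3 = -1" using f xv h3 by simp
        have "bal 1 = 1" using bal_step[of 1] bal_zero D1(5) 1 by simp
        then have two: "2 \<in> B" using bal_step[of 2] bal_step[of 3] B3 b3 by (auto split: if_splits)
        have "y2 = 4 \<or> y2 = 5 \<or> y2 = 6" using right xv h3 D2(2) m1 by auto
        then show ?thesis using d2(2) D2(5) q two B3 w3 h3 by auto
      next
        case False
        \<comment> \<open>The window \<open>{h, h + 1, h + 2}\<close>.\<close>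
        have "gaps (h - 1) (h - 1 + w) \<le> 1"
          using gaps_split[of "h - 1" h "h + 2"] gaps_split[of h "h + 1" "h + 2"]
            gaps_succ[of h "h - 1"] gaps_succ[of "h + 1" h] gaps_succ[of "h + 2" "h + 1"] q pr w3
          by (auto simp: add.commute)
        moreover have "card (loss (h - 1)) = 0" using loss_empty[OF wB, of "h - 1"] w3 False by simp
        moreover have "gaps (x - 1) (m - 1) = 2" using top_gaps x f ct by simp
        ultimately show ?thesis using chain_gaps[of "h - 1"] xv False by simp
      qed
    qed
  qed
qed

text \<open>Here \<open>w = 4\<close>. For \<open>c = 2\<close> poor holes are even and the midpoint \<open>q = (y1 + m) / 2\<close> lies in \<open>B\<close>. Each of the
pairs \<open>q - 1, q + 1\<close> and \<open>q - 2, q + 2\<close> has at most one hole, so one of the two windows of length 4 that contain \<open>q - 1, q, q + 1\<close> has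
at most one. The loss \<open>2 w = 8\<close> could interfere only for \<open>m = 10\<close>, where \<open>y2\<close> finds no place.\<close>
lemma two_poor_c2_t0:
  assumes x: "1 \<le> x" and f: "bal (x - 1) \<le> -1" and ct: "c = 2" "t = 0"
    and y: "y1 \<in> poor" "y2 \<in> poor" "y1 < y2" "y1 < x" and wB: "w \<in> B"
  shows "1 - bal (x - 1) \<le> 2 * int (card rich)"
proof -
  note d1 = poorD[OF y(1)] and d2 = poorD[OF y(2)]
  note D1 = doubleD[OF d1(1)] and D2 = doubleD[OF d2(1)]
  have w4: "w = 4" using w_eq ct by simp
  have B4: "4 \<in> B" using wB w4 by simp
  have m2: "m = 2 * h + 2" using m_eq ct by simp
  have xv: "x = 2 * h - 2" using x_val ct by simp
  have ev: "even y1" "even y2" using double_c2[OF ct(1)] d1(1) d2(1) by auto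
  obtain k where k: "y1 = 2 * k" using ev(1) by (rule evenE)
  have k1: "1 \<le> k" using k D1(1) by simp
  have kh: "k \<le> h - 2" using poor_left[OF y(1,4)] f xv k by simp
  define q where "q = k + h + 1"
  have q2: "2 * q = y1 + m" using q_def k m2 by simp
  have cov: "z \<in> B \<or> 2 * q - z \<in> B" if "q - 3 \<le> z" "z \<le> q + 3" for z
  proof -
    have "y1 \<le> z" "z \<le> m" using that kh k m2 q_def by linarith+
    then show ?thesis using double_cover_high[OF d1(1), of z] q2 by simp
  qed
  have qB: "q \<in> B" using cov[of q] by simp
  have p1: "q - 1 \<in> B \<or> q + 1 \<in> B" using cov[of "q - 1"] by simp
  have p2: "q - 2 \<in> B \<or> q + 2 \<in> B" using cov[of "q - 2"] by simp
  \<comment> \<open>The window is \<open>{q - 2..q + 1}\<close> or \<open>{q - 1..q + 2}\<close>: whichever of \<open>q - 2\<close> and \<open>q + 2\<close> it contains is in \<open>B\<close>.\<close>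
  define p where "p = (if q - 2 \<in> B then q - 3 else q - 2)"
  have g: "gaps p (p + w) \<le> 1"
  proof (cases "q - 2 \<in> B")
    case True
    have "gaps (q - 3) (q - 3 + 4) \<le> 1" unfolding gaps4
      using gaps_succ[of "q - 2" "q - 3"] gaps_succ[of "q - 1" "q - 2"] gaps_succ[of q "q - 1"]
        gaps_succ[of "q + 1" q] True qB p1 by (auto simp: add.commute)
    then show ?thesis using True p_def w4 by simp
  next
    case False
    have "gaps (q - 2) (q - 2 + 4) \<le> 1" unfolding gaps4
      using gaps_succ[of "q - 1" "q - 2"] gaps_succ[of q "q - 1"]
        gaps_succ[of "q + 1" q] gaps_succ[of "q + 2" "q + 1"] False qB p1 p2 by (auto simp: add.commute)
    then show ?thesis using False p_def w4 by simp
  qed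
  have "card (loss p) = 0"
  proof (rule ccontr)
    assume "card (loss p) \<noteq> 0"
    then obtain s where s: "s \<in> loss p" by (metis card.empty ex_in_conv)
    have S: "8 \<notin> B" "p < 4" "8 \<le> 2 * h" using lossD[OF wB s] w4 by auto
    then have "k = 1" "h = 4" using p_def q_def k1 by (auto split: if_splits)
    then have v: "y1 = 2" "x = 6" "q = 6" using k xv q_def by auto
    have "y2 = 4 \<or> y2 = 6 \<or> y2 = 8"
    proof (cases "y2 < x")
      case True
      then have "y2 \<le> 4" using poor_left[OF y(2) True] f v by simp
      then show ?thesis using ev(2) y(3) v by presburger
    next
      case False
      then have "6 \<le> y2" "y2 \<le> 8" using poor_right(2)[OF y(2) _ x] v \<open>h = 4\<close> by auto
      then show ?thesis using ev(2) by presburger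
    qed
    then show False using d2(2,3) D2(5) w4 qB v B4 by auto
  qed
  then have "gaps (x - 1) (m - 1) \<le> 1 + int (card rich)"
    using chain_gaps[of p] g kh k1 p_def q_def xv by (auto split: if_splits)
  then show ?thesis using top_gaps x ct by simp
qed

text \<open>The midpoint argument with \<open>w = 5\<close>, where the window \<open>q - 2, ..., q + 2\<close> is mapped to itself. The loss could interfere only
for \<open>m = 12\<close>.\<close>
lemma two_poor_c2_t1:
  assumes x: "1 \<le> x" and f: "bal (x - 1) = -2" and ct: "c = 2" "t = 1"
    and y: "y1 \<in> poor" "y2 \<in> poor" "y1 < y2" "y1 < x"
    and wB: "w \<in> B" and ls: "2 * w \<in> loss y1"
  shows "1 \<le> card rich"
proof -
  note d1 = poorD[OF y(1)] and d2 = poorD[OF y(2)]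
  note D1 = doubleD[OF d1(1)] and D2 = doubleD[OF d2(1)]
  have w5: "w = 5" using w_eq ct by simp
  have B5: "5 \<in> B" using wB w5 by simp
  have m2: "m = 2 * h + 2" using m_eq ct by simp
  have xv: "x = 2 * h - 3" using x_val ct by simp
  have L: "10 \<notin> B" "10 \<le> 2 * h" using lossD[OF wB ls] w5 by auto
  have ev: "even y1" "even y2" using double_c2[OF ct(1)] d1(1) d2(1) by auto
  obtain k where k: "y1 = 2 * k" using ev(1) by (rule evenE)
  have k1: "1 \<le> k" using k D1(1) by simp
  have kh: "k \<le> h - 3" using poor_left[OF y(1,4)] f xv k by simp
  define q where "q = k + h + 1"
  have q2: "2 * q = y1 + m" using q_def k m2 by simp
  have cov: "z \<in> B \<or> 2 * q - z \<in> B" if "q - 3 \<le> z" "z \<le> q + 3" for z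
  proof -
    have "y1 \<le> z" "z \<le> m" using that kh k m2 q_def by linarith+
    then show ?thesis using double_cover_high[OF d1(1), of z] q2 by simp
  qed
  have qB: "q \<in> B" using cov[of q] by simp
  have p1: "q - 1 \<in> B \<or> q + 1 \<in> B" using cov[of "q - 1"] by simp
  have p2: "q - 2 \<in> B \<or> q + 2 \<in> B" using cov[of "q - 2"] by simp
  have "gaps (q - 3) (q - 3 + 5) = gaps (q - 3) (q - 3 + 4) + gaps (q + 1) (q + 2)"
    using gaps_split[of "q - 3" "q + 1" "q + 2"] by (simp add: add.commute)
  then have g: "gaps (q - 3) (q - 3 + w) \<le> 2" unfolding gaps4 w5
    using gaps_succ[of "q - 2" "q - 3"] gaps_succ[of "q - 1" "q - 2"] gaps_succ[of q "q - 1"]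
        gaps_succ[of "q + 1" q] gaps_succ[of "q + 2" "q + 1"] qB p1 p2 by (auto simp: add.commute)
  have "card (loss (q - 3)) = 0"
  proof (rule ccontr)
    assume "card (loss (q - 3)) \<noteq> 0"
    then obtain s where s: "s \<in> loss (q - 3)" by (metis card.empty ex_in_conv)
    have "q - 3 < 5" using lossD[OF wB s] w5 by auto
    then have kk: "k = 1" "h = 5" using q_def k1 L by auto
    then have v: "y1 = 2" "x = 7" using k xv by auto
    have "y2 = 4 \<or> y2 = 8 \<or> y2 = 10"
    proof (cases "y2 < x")
      case True
      then have "y2 \<le> 4" using poor_left[OF y(2) True] f v by simp
      then show ?thesis using ev(2) y(3) v by presburger
    next
      case False
      then have "7 \<le> y2" "y2 \<le> 10" using poor_right(2)[OF y(2) _ x] v kk by auto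
      then show ?thesis using ev(2) by presburger
    qed
    then show False
    proof (elim disjE)
      assume e: "y2 = 4"
      have one: "1 \<in> B" using double_cover_low[OF d1(1), of 1] v by simp
      have b: "bal 2 = 0" "bal 4 = 0" using double_c2(1)[OF ct(1)] d1(1) d2(1) v e by auto
      then have "3 \<in> B" using bal_step[of 3] bal_step[of 4] D2(5) e by (auto split: if_splits)
      then show False using double_pair[OF d2(1) one, of 3] e by simp
    next
      assume "y2 = 8"
      then show False using near_top[OF ct(1)] d2(1) L kk by simp
    next
      assume "y2 = 10"
      then show False using d2(2) w5 B5 by simp
    qed
  qed
  then have "gaps (x - 1) (m - 1) \<le> 2 + int (card rich)"
    using chain_gaps[of "q - 3"] g kh k1 q_def xv by auto
  then show ?thesis using top_gaps x f ct by simp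
qed

text \<open>The reflection in the smaller poor hole suffices, except for the three borderline parameter
combinations treated before.\<close>
lemma two_poor:
  assumes x: "1 \<le> x" and f: "bal (x - 1) \<le> - t - 1"
    and y: "y1 \<in> poor" "y2 \<in> poor" "y1 < y2"
  shows "- bal (x - 1) - t + 1 \<le> 2 * int (card rich)"
proof (cases "x \<le> y1")
  case True
  then show ?thesis using two_poor_right[OF x f y] by simp
next
  case False
  then have y1x: "y1 < x" by simp
  have wB: "w \<in> B" using w_in_two_poor[OF x f y y1x] .
  have mb: "1 - c - bal (x - 1) \<le> int (card rich) + int (card (loss y1))" using mirror_bound[OF y(1) y1x] .
  have c12: "c = 1 \<or> c = 2" using doubleD(8)[OF poorD(1)[OF y(1)]] c_pos by linarith
  obtain k where k: "bal (x - 1) + t = 2 * k + 1" using balance_parity by (rule oddE)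
  have l: "card (loss y1) = 0 \<or> card (loss y1) = 1 \<and> 2 * w \<in> loss y1"
  proof (cases "loss y1 = {}")
    case False
    then obtain s where "s \<in> loss y1" by blast
    then have "2 * w \<in> loss y1" using lossD(1)[OF wB] by blast
    moreover have "card (loss y1) \<noteq> 0" using False finite_sets(3) by simp
    ultimately show ?thesis using card_loss[OF wB, of y1] by linarith
  qed simp
  show ?thesis
  proof (cases "c = 2 \<and> t = 0")
    case True
    then show ?thesis using two_poor_c2_t0[OF x _ _ _ y y1x wB] f by simp
  next
    case n1: False
    show ?thesis
    proof (cases "c = 1 \<and> t = 0 \<and> bal (x - 1) = -1 \<and> 2 * w \<in> loss y1")
      case True
      then show ?thesis using two_poor_c1_t0[OF x _ _ _ y y1x wB] by simp
    next
      case n2: False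
      show ?thesis
      proof (cases "c = 2 \<and> t = 1 \<and> bal (x - 1) = -2 \<and> 2 * w \<in> loss y1")
        case True
        then show ?thesis using two_poor_c2_t1[OF x _ _ _ y y1x wB] by simp
      next
        case n3: False
        define R where "R = int (card rich)"
        define l' where "l' = int (card (loss y1))"
        have l': "l' = 0 \<or> l' = 1 \<and> 2 * w \<in> loss y1" using l unfolding l'_def by auto
        have mb': "1 - c - bal (x - 1) \<le> R + l'" using mb unfolding R_def l'_def .
        have "- bal (x - 1) - t + 1 \<le> 2 * R" using l' c12
        proof (elim disjE conjE)
          assume "l' = 0" "c = 1"
          then show ?thesis using mb' f t_nonneg by linarith
        next
          assume "l' = 0" "c = 2"
          then show ?thesis using mb' f t_nonneg n1 by linarith
        next
          assume "l' = 1" "2 * w \<in> loss y1" "c = 1"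
          then have "3 - t \<le> - bal (x - 1)" using f t_nonneg n2 k by presburger
          then show ?thesis using mb' \<open>l' = 1\<close> \<open>c = 1\<close> by linarith
        next
          assume "l' = 1" "2 * w \<in> loss y1" "c = 2"
          then have "5 - t \<le> - bal (x - 1)" using f t_nonneg n1 n3 k by presburger
          then show ?thesis using mb' \<open>l' = 1\<close> \<open>c = 2\<close> by linarith
        qed
        then show ?thesis unfolding R_def .
      qed
    qed
  qed
qed

end

context dense_block_end
begin

section \<open>Counting the sums\<close>

lemma card_poor_le: "card poor \<le> 2"
proof -
  have "finite {y. doubly_missing y}" by (rule finite_subset[of _ "{0..m}"]) (auto simp: doubly_missing_def)
  then have "card poor \<le> card {y. doubly_missing y}" using poor_double by (intro card_mono) auto
  then show ?thesis using card_doubles by linarith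
qed

text \<open>By \<open>top_gaps\<close> the claim is \<open>2 * card poor - bal (x - 1) \<le> t + 3 + 2 * card rich\<close>. It is trivial unless \<open>bal (x - 1)\<close> is very
negative; then the lower bounds on rich holes for zero, one and two poor holes apply, with the parity of \<open>bal (x - 1) + t\<close>
closing the gap of one between the two ranges. If \<open>x \<le> 0\<close>, the top window covers all \<open>h\<close> holes, and the poor ones are at most \<open>h\<close>.\<close>
lemma poor_top_rich: "int (card poor) + gaps (x - 1) (m - 1) \<le> t + 3 + int (card rich)"
proof (cases "1 \<le> x")
  case False
  have "card poor \<le> card ({-1<..m} - B)" unfolding poor_def by (intro card_mono) auto
  then have "int (card poor) \<le> h" using gaps_total unfolding gaps_def by simp
  moreover have "gaps (x - 1) (m - 1) = gaps (x - 1) (-1) + gaps (-1) (m - 1)"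
    using False m_pos by (intro gaps_split) auto
  moreover have "gaps (x - 1) (-1) \<le> - x" using gaps_le[of "x - 1" "-1"] False by simp
  moreover have "gaps (-1) (m - 1) \<le> h"
    using gaps_split[of "-1" "m - 1" m] gaps_nonneg[of "m - 1" m] gaps_total m_pos by simp
  ultimately show ?thesis using x_val by linarith
next
  case x: True
  have top: "2 * gaps (x - 1) (m - 1) = t + 3 - bal (x - 1)" using top_gaps x by simp
  obtain k where k: "bal (x - 1) + t = 2 * k + 1" using balance_parity by (rule oddE)
  consider "card poor = 0" | "card poor = 1" | "card poor = 2" using card_poor_le by linarith
  then show ?thesis
  proof cases
    case 1
    then show ?thesis using card_rich_ge[OF x] top by (cases "bal (x - 1) \<le> - t - 4") auto
  next
    case 2
    then obtain y where "y \<in> poor" by (metis card.empty ex_in_conv zero_neq_one)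
    then have c2: "c \<le> 2" using doubleD(8) poor_double by blast
    show ?thesis
    proof (cases "bal (x - 1) \<le> - t - 2")
      case True
      then have "bal (x - 1) \<le> - t - 3" using k by presburger
      then show ?thesis using card_rich_ge_small_c[OF x _ c2] top 2 by simp
    next
      case False
      then show ?thesis using top 2 by simp
    qed
  next
    case 3
    then obtain a b where ab: "poor = {a, b}" "a \<noteq> b" by (meson card_2_iff)
    show ?thesis
    proof (cases "bal (x - 1) \<le> - t")
      case True
      then have f: "bal (x - 1) \<le> - t - 1" using k by presburger
      have "- bal (x - 1) - t + 1 \<le> 2 * int (card rich)"
        using two_poor[OF x f, of a b] two_poor[OF x f, of b a] ab by (cases "a < b") auto
      then show ?thesis using top 3 by simp
    next
      case False
      then show ?thesis using top 3 by simp
    qed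
  qed
qed

text \<open>The sums are counted in four separate ranges: below \<open>m\<close>, at \<open>m\<close>, between \<open>m\<close> and \<open>2 m\<close>, and from \<open>2 m\<close> on. The
first and third lack the sets \<open>M1\<close> and \<open>M2\<close>, whose union consists of the holes that are not rich and whose
intersection consists of the poor ones.\<close>
lemma card_restricted_sumset:
  "3 * int (card B) - 4 \<le> int (card (restricted_sumset (insert (m + w) B)))"
proof -
  define T where "T = restricted_sumset (insert (m + w) B)"
  define I where "I = {1..<m}"
  define M1 where "M1 = {v \<in> I. v \<notin> RS}"
  define M2 where "M2 = {v \<in> I. v + m \<notin> RS \<and> v - w \<notin> B}"
  define P1 where "P1 = I - M1"
  define P2 where "P2 = (\<lambda>v. v + m) ` (I - M2)"
  define P3 where "P3 = (\<lambda>b. b + (m + w)) ` ({x - 1<..m} \<inter> B)"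
  have finI: "finite I" and cI: "int (card I) = m - 1" using m_pos by (auto simp: I_def)
  have fin: "finite M1" "finite M2" "finite P1" "finite P2" "finite P3"
    using finI unfolding M1_def M2_def P1_def P2_def P3_def by auto
  have RST: "RS \<subseteq> T" unfolding T_def restricted_sumset_def by blast
  have BT: "b + (m + w) \<in> T" if "b \<in> B" for b
  proof -
    have "b \<noteq> m + w" using B_bounds[OF that] w_pos by linarith
    then show ?thesis unfolding T_def by (intro restricted_sumsetI[of b _ "m + w"]) (use that in auto)
  qed
  have sub: "P1 \<union> {m} \<union> P2 \<union> P3 \<subseteq> T"
  proof -
    have "P1 \<subseteq> T" using RST unfolding P1_def M1_def by auto
    moreover have "m \<in> T" using RS_I[OF zero_in m_in] m_pos RST by auto
    moreover have "P2 \<subseteq> T"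
    proof
      fix z assume "z \<in> P2"
      then obtain v where v: "z = v + m" "v + m \<in> RS \<or> v - w \<in> B" unfolding P2_def M2_def by auto
      then show "z \<in> T" using RST BT[of "v - w"] by auto
    qed
    moreover have "P3 \<subseteq> T" using BT unfolding P3_def by auto
    ultimately show ?thesis by blast
  qed
  have finT: "finite T"
  proof (rule finite_subset)
    show "T \<subseteq> (\<lambda>(a, b). a + b) ` (insert (m + w) B \<times> insert (m + w) B)"
      unfolding T_def restricted_sumset_def by force
    show "finite ((\<lambda>(a, b). a + b) ` (insert (m + w) B \<times> insert (m + w) B))"
      using finite_B by simp
  qed
  have "card (P1 \<union> {m} \<union> P2 \<union> P3) = card P1 + 1 + card P2 + card P3"
  proof -
    have "(P1 \<union> {m} \<union> P2) \<inter> P3 = {}"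
      using x_eq B_bounds w_pos unfolding P1_def P2_def P3_def I_def by fastforce
    moreover have "(P1 \<union> {m}) \<inter> P2 = {}" unfolding P1_def P2_def I_def by auto
    moreover have "P1 \<inter> {m} = {}" unfolding P1_def I_def by auto
    ultimately show ?thesis using fin by (simp add: card_Un_disjoint)
  qed
  then have lower: "card P1 + 1 + card P2 + card P3 \<le> card T" using card_mono[OF finT sub] by simp
  have "card P1 + card M1 = card I"
    unfolding P1_def using finI by (subst card_Diff_subset) (auto simp: M1_def card_mono)
  moreover have "card P2 = card (I - M2)" unfolding P2_def by (rule card_image) (auto simp: inj_on_def)
  moreover have "card (I - M2) + card M2 = card I"
    using finI by (subst card_Diff_subset) (auto simp: M2_def card_mono)
  moreover have "card P3 = card ({x - 1<..m} \<inter> B)"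
    unfolding P3_def by (rule card_image) (auto simp: inj_on_def)
  moreover have "int (card ({x - 1<..m} \<inter> B)) = w + 1 - gaps (x - 1) (m - 1)"
    using gaps_add_card[of "x - 1" m] gaps_split[of "x - 1" "m - 1" m] gaps_unit[of m] m_in x_eq w_pos by simp
  moreover have "int (card M1) + int (card M2) = h - int (card rich) + int (card poor)"
  proof -
    have "card M1 + card M2 = card (M1 \<union> M2) + card (M1 \<inter> M2)" using fin by (intro card_Un_Int) auto
    moreover have hole1: "v \<notin> B" if "v \<in> M1" for v
      using that not_in_B_if_missing unfolding M1_def I_def by auto
    moreover have hole2: "v \<notin> B" if "v \<in> M2" for v
      using that not_in_B_if_missing_high unfolding M2_def I_def by auto
    moreover have "M1 \<inter> M2 = poor" using hole1 unfolding M1_def M2_def poor_def I_def by blast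
    moreover have "M1 \<union> M2 = ({-1<..m} - B) - rich"
    proof -
      have "v \<in> I" if "v \<in> {-1<..m} - B" for v
        using that zero_in m_in unfolding I_def by (cases "v = 0"; cases "v = m") auto
      moreover have "I \<subseteq> {-1<..m}" unfolding I_def by auto
      ultimately show ?thesis using hole1 hole2 unfolding M1_def M2_def rich_def I_def by blast
    qed
    moreover have "int (card (({-1<..m} - B) - rich)) = h - int (card rich)"
    proof -
      have "rich \<subseteq> {-1<..m} - B" unfolding rich_def by auto
      then have "card (({-1<..m} - B) - rich) + card rich = card ({-1<..m} - B)"
        using finite_sets(1) card_mono[of "{-1<..m} - B" rich] by (simp add: card_Diff_subset)
      then show ?thesis using gaps_total unfolding gaps_def by linarith
    qed
    ultimately show ?thesis by simp
  qed
  ultimately have "2 * m - h + w - (t + 3) \<le> int (card T)" using lower cI poor_top_rich by linarith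
  then show ?thesis unfolding T_def[symmetric] using card_B m_eq w_eq by linarith
qed

end

theorem theorem1p1:
  fixes k :: nat and a :: "nat \<Rightarrow> int" and A :: "int set"
  assumes "k \<ge> 3"
    and "A = a ` {..<k}"
    and "a 0 = 0"
    and "strict_mono_on {..<k} a"
    and "a (k - 2) < 2 * int k - 4"
    and "a (k - 1) \<ge> 2 * int k - 2"
    and "set_gcd A = 1"
  shows "int (card (restricted_sumset A)) \<ge> 3 * int k - 7"
proof -
  \<comment> \<open>With \<open>n = k - 1\<close> elements in \<open>B\<close>, the hypotheses give \<open>c = 2 n - 2 - m \<ge> 1\<close> and \<open>t = a (k - 1) - 2 n \<ge> 0\<close>.\<close>
  define B where "B = a ` {..<k - 1}"
  define m where "m = a (k - 2)"
  define h where "h = m + 1 - int (k - 1)"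
  define c where "c = m - 2 * h"
  define w where "w = a (k - 1) - m"
  define t where "t = w - c - 2"
  have mono: "a i \<le> a j" if "i \<le> j" "j < k" for i j
    using strict_mono_onD[OF assms(4), of i j] that by (cases "i = j") auto
  have inj: "inj_on a {..<k - 1}"
    using strict_mono_on_imp_inj_on[OF assms(4)] by (rule inj_on_subset) auto
  have "B \<subseteq> {0..m}"
  proof
    fix z assume "z \<in> B"
    then obtain i where i: "z = a i" "i < k - 1" unfolding B_def by auto
    then show "z \<in> {0..m}" using mono[of 0 i] mono[of i "k - 2"] assms(1,3) unfolding m_def by auto
  qed
  moreover have "0 \<in> B" unfolding B_def using assms(1,3) by (intro image_eqI[of _ _ 0]) auto
  moreover have "m \<in> B" unfolding B_def m_def using assms(1) by (intro imageI) auto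
  moreover have cB: "card B = k - 1" unfolding B_def using card_image[OF inj] by simp
  moreover have "1 \<le> c" unfolding c_def h_def using assms(1,5) m_def by simp
  moreover have "0 \<le> t" unfolding t_def w_def c_def h_def using assms(1,6) by simp
  ultimately interpret dense_block_end B m h c t w "m - w"
    by unfold_locales (auto simp: h_def c_def t_def)
  have "{..<k} = insert (k - 1) {..<k - 1}" using assms(1) by auto
  then have "A = insert (m + w) B" unfolding assms(2) B_def w_def by simp
  then show ?thesis using card_restricted_sumset cB assms(1) by simp
qed

end
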